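(* Let $\Gamma$ be a group and let $\Lambda\leq\Gamma$ be a commensurated subgroup. Then $B(\Gamma,\Lambda)=\partial_F\Lambda$, i.e. $B(\Gamma,\Lambda)$ is $\Gamma$-equivariantly homeomorphic to $\partial_F\Lambda$.
   Context: Groups are discrete. A subgroup $\Lambda\leq\Gamma$ is commensurated if $[\Lambda:\Lambda\cap g\Lambda g^{-1}]<\infty$ for every $g\in\Gamma$. For an action of a group $G$ by homeomorphisms on a compact Hausdorff space $X$: the action is minimal if $X$ contains no non-trivial (non-empty proper) closed invariant subset; it is proximal if for all $x,y\in X$ there is a net $(g_i)\subset G$ such that $(g_ix)$ and $(g_iy)$ converge and $\lim g_ix=\lim g_iy$; it is strongly proximal if the induced action of $G$ on the space $\mathrm{Prob}(X)$ of regular probability measures on $X$ (weak* topology) is proximal. $X$ is a $G$-boundary if the action is minimal and strongly proximal. The Furstenberg boundary $\partial_FG$ is the universal $G$-boundary, i.e. the $G$-boundary of which every $G$-boundary is a continuous $G$-equivariant image. When $\Lambda\leq\Gamma$ is commensurated, the action $\Lambda\curvearrowright\partial_F\Lambda$ extends in a unique way to an action of $\Gamma$ on $\partial_F\Lambda$ by homeomorphisms, and $\partial_F\Lambda$ is regarded as a $\Gamma$-space through this extension. For groups $\Lambda\leq\Gamma$, $B(\Gamma,\Lambda)$ denotes the universal $\Lambda$-strongly proximal $\Gamma$-boundary (Ursu): it is a $\Gamma$-boundary on which the restricted action of $\Lambda$ is strongly proximal, and every $\Gamma$-boundary on which $\Lambda$ acts strongly proximally is a continuous $\Gamma$-equivariant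 image of it. *)

theory Defs
  imports "HOL-Probability.Probability" "HOL-Algebra.Group_Action"
begin

subsection \<open>Commensurated subgroups\<close>

definition commensurated :: "'g set \<Rightarrow> ('g, 'm) monoid_scheme \<Rightarrow> bool" where
  "commensurated \<Lambda> \<Gamma> \<longleftrightarrow> subgroup \<Lambda> \<Gamma> \<and>
     (\<forall>g\<in>carrier \<Gamma>.
        finite (rcosets\<^bsub>\<Gamma>\<lparr>carrier := \<Lambda>\<rparr>\<^esub>
          (\<Lambda> \<inter> (\<lambda>h. g \<otimes>\<^bsub>\<Gamma>\<^esub> h \<otimes>\<^bsub>\<Gamma>\<^esub> inv\<^bsub>\<Gamma>\<^esub> g) ` \<Lambda>)))"

subsection \<open>Regular probability measures with the weak* topology\<close>

definition borel_of :: "'a topology \<Rightarrow> 'a measure" where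
  "borel_of X = sigma (topspace X) {U. openin X U}"

definition Prob :: "'a topology \<Rightarrow> 'a measure set" where
  "Prob X = {\<mu>. sets \<mu> = sets (borel_of X) \<and> prob_space \<mu> \<and>
     (\<forall>A\<in>sets \<mu>.
        emeasure \<mu> A = (INF U\<in>{U. openin X U \<and> A \<subseteq> U}. emeasure \<mu> U) \<and>
        emeasure \<mu> A = (SUP K\<in>{K. compactin X K \<and> K \<in> sets \<mu> \<and> K \<subseteq> A}. emeasure \<mu> K))}"

text \<open>The initial topology on the regular probability measures for the maps given by integration
  against the continuous real functions.\<close>

definition weak_star :: "'a topology \<Rightarrow> 'a measure topology" where
  "weak_star X =
     pullback_topology (Prob X)
       (\<lambda>\<mu>. \<lambda>f\<in>{f. continuous_map X euclideanreal f}. \<integral>x. f x \<partial>\<mu>)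
       (product_topology (\<lambda>_. euclideanreal) {f. continuous_map X euclideanreal f})"

subsection \<open>Boundaries\<close>

definition action_by_homeos ::
    "('g, 'm) monoid_scheme \<Rightarrow> 'a topology \<Rightarrow> ('g \<Rightarrow> 'a \<Rightarrow> 'a) \<Rightarrow> bool" where
  "action_by_homeos G X \<phi> \<longleftrightarrow>
     group_action G (topspace X) \<phi> \<and> (\<forall>g\<in>carrier G. homeomorphic_map X X (\<phi> g))"

definition minimal_action ::
    "('g, 'm) monoid_scheme \<Rightarrow> 'a topology \<Rightarrow> ('g \<Rightarrow> 'a \<Rightarrow> 'a) \<Rightarrow> bool" where
  "minimal_action G X \<phi> \<longleftrightarrow>
     (\<forall>C. closedin X C \<and> (\<forall>g\<in>carrier G. \<phi> g ` C \<subseteq> C) \<longrightarrow> C = {} \<or> C = topspace X)"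

text \<open>Nets in the group are rendered by proper filters on it: a net gives the filter of the sets
  that eventually contain it, and every proper filter arises in this way.\<close>

definition proximal ::
    "('g, 'm) monoid_scheme \<Rightarrow> 'a topology \<Rightarrow> ('g \<Rightarrow> 'a \<Rightarrow> 'a) \<Rightarrow> bool" where
  "proximal G X \<phi> \<longleftrightarrow>
     (\<forall>x\<in>topspace X. \<forall>y\<in>topspace X. \<exists>F. F \<noteq> bot \<and> (\<forall>\<^sub>F g in F. g \<in> carrier G) \<and>
        (\<exists>z. limitin X (\<lambda>g. \<phi> g x) z F \<and> limitin X (\<lambda>g. \<phi> g y) z F))"

definition strongly_proximal ::
    "('g, 'm) monoid_scheme \<Rightarrow> 'a topology \<Rightarrow> ('g \<Rightarrow> 'a \<Rightarrow> 'a) \<Rightarrow> bool" where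
  "strongly_proximal G X \<phi> \<longleftrightarrow>
     proximal G (weak_star X) (\<lambda>g \<mu>. distr \<mu> (borel_of X) (\<phi> g))"

definition boundary ::
    "('g, 'm) monoid_scheme \<Rightarrow> 'a topology \<Rightarrow> ('g \<Rightarrow> 'a \<Rightarrow> 'a) \<Rightarrow> bool" where
  "boundary G X \<phi> \<longleftrightarrow>
     compact_space X \<and> Hausdorff_space X \<and> topspace X \<noteq> {} \<and> action_by_homeos G X \<phi> \<and>
     minimal_action G X \<phi> \<and> strongly_proximal G X \<phi>"

definition equivariant ::
    "('g, 'm) monoid_scheme \<Rightarrow> 'a topology \<Rightarrow> ('g \<Rightarrow> 'a \<Rightarrow> 'a) \<Rightarrow> ('g \<Rightarrow> 'b \<Rightarrow> 'b) \<Rightarrow> ('a \<Rightarrow> 'b) \<Rightarrow> bool" where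
  "equivariant G X \<phi> \<psi> f \<longleftrightarrow> (\<forall>g\<in>carrier G. \<forall>x\<in>topspace X. f (\<phi> g x) = \<psi> g (f x))"

definition equivariant_image ::
    "('g, 'm) monoid_scheme \<Rightarrow> 'a topology \<Rightarrow> ('g \<Rightarrow> 'a \<Rightarrow> 'a) \<Rightarrow>
     'b topology \<Rightarrow> ('g \<Rightarrow> 'b \<Rightarrow> 'b) \<Rightarrow> bool" where
  "equivariant_image G X \<phi> Z \<zeta> \<longleftrightarrow>
     (\<exists>f. continuous_map X Z f \<and> f ` topspace X = topspace Z \<and> equivariant G X \<phi> \<zeta> f)"

text \<open>The universal properties quantify over the boundaries whose points are sets of subsets of the
  group. This is no restriction: every boundary is equivariantly homeomorphic to one of these, since
  it has a dense orbit; see \<open>furstenberg_boundary_universal\<close> and \<open>relative_boundary_universal\<close> below.\<close>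

definition furstenberg_boundary ::
    "('g, 'm) monoid_scheme \<Rightarrow> 'a topology \<Rightarrow> ('g \<Rightarrow> 'a \<Rightarrow> 'a) \<Rightarrow> bool" where
  "furstenberg_boundary G X \<phi> \<longleftrightarrow>
     boundary G X \<phi> \<and>
     (\<forall>(Z :: 'g set set topology) \<zeta>. boundary G Z \<zeta> \<longrightarrow> equivariant_image G X \<phi> Z \<zeta>)"

text \<open>\<open>relative_boundary \<Gamma> \<Lambda> X \<phi>\<close> says that \<open>X\<close> with the action \<open>\<phi>\<close> is
  the space $B(\Gamma,\Lambda)$.\<close>

definition relative_boundary ::
    "('g, 'm) monoid_scheme \<Rightarrow> 'g set \<Rightarrow> 'a topology \<Rightarrow> ('g \<Rightarrow> 'a \<Rightarrow> 'a) \<Rightarrow> bool" where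
  "relative_boundary \<Gamma> \<Lambda> X \<phi> \<longleftrightarrow>
     boundary \<Gamma> X \<phi> \<and> strongly_proximal (\<Gamma>\<lparr>carrier := \<Lambda>\<rparr>) X \<phi> \<and>
     (\<forall>(Z :: 'g set set topology) \<zeta>.
        boundary \<Gamma> Z \<zeta> \<and> strongly_proximal (\<Gamma>\<lparr>carrier := \<Lambda>\<rparr>) Z \<zeta> \<longrightarrow>
        equivariant_image \<Gamma> X \<phi> Z \<zeta>)"

subsection \<open>Every boundary is represented on sets of subsets of the group\<close>

lemma space_borel_of [simp]: "space (borel_of X) = topspace X"
  unfolding borel_of_def by (rule space_measure_of) (auto dest: openin_subset)

lemma sets_borel_of: "sets (borel_of X) = sigma_sets (topspace X) {U. openin X U}"
  unfolding borel_of_def by (rule sets_measure_of) (auto dest: openin_subset)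

lemma borel_of_openin: "openin X U \<Longrightarrow> U \<in> sets (borel_of X)"
  by (simp add: sets_borel_of sigma_sets.Basic)

lemma measurable_borel_of:
  assumes "continuous_map X Y f"
  shows "f \<in> measurable (borel_of X) (borel_of Y)"
proof -
  have "f \<in> measurable (borel_of X) (sigma (topspace Y) {U. openin Y U})"
  proof (rule measurable_measure_of)
    show "{U. openin Y U} \<subseteq> Pow (topspace Y)" by (auto dest: openin_subset)
    show "f \<in> space (borel_of X) \<rightarrow> topspace Y"
      using assms by (auto simp: continuous_map_def)
    fix U assume "U \<in> {U. openin Y U}"
    then have "openin X {x \<in> topspace X. f x \<in> U}"
      using assms by (auto simp: continuous_map_def)
    moreover have "f -` U \<inter> space (borel_of X) = {x \<in> topspace X. f x \<in> U}" by auto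
    ultimately show "f -` U \<inter> space (borel_of X) \<in> sets (borel_of X)"
      by (simp add: borel_of_openin)
  qed
  then show ?thesis by (simp add: borel_of_def)
qed

lemma measurable_borel_of_real:
  assumes "continuous_map X euclideanreal f"
  shows "f \<in> borel_measurable (borel_of X)"
proof -
  have "sets (borel_of euclideanreal) = sets borel"
    by (simp add: sets_borel_of borel_def sets_measure_of)
  then show ?thesis
    using measurable_borel_of[OF assms] by (metis measurable_cong_sets)
qed

lemma ProbD:
  assumes "\<mu> \<in> Prob X"
  shows "sets \<mu> = sets (borel_of X)" "prob_space \<mu>" "space \<mu> = topspace X"
  using assms sets_eq_imp_space_eq[of \<mu> "borel_of X"] by (auto simp: Prob_def)

lemma topspace_weak_star [simp]: "topspace (weak_star X) = Prob X"
  by (auto simp: weak_star_def topspace_pullback_topology)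

lemma limitin_weak_star:
  "limitin (weak_star X) m \<mu> F \<longleftrightarrow>
     \<mu> \<in> Prob X \<and> (\<forall>\<^sub>F i in F. m i \<in> Prob X) \<and>
     (\<forall>f. continuous_map X euclideanreal f \<longrightarrow> ((\<lambda>i. \<integral>x. f x \<partial>(m i)) \<longlongrightarrow> (\<integral>x. f x \<partial>\<mu>)) F)"
  (is "?L \<longleftrightarrow> ?R")
proof
  let ?C = "{f. continuous_map X euclideanreal f}"
  let ?I = "\<lambda>\<mu>. \<lambda>f\<in>?C. \<integral>x. f x \<partial>\<mu>"
  let ?T = "product_topology (\<lambda>_. euclideanreal) ?C"
  {
    assume L: ?L
    then have \<mu>: "\<mu> \<in> Prob X" by (auto simp: limitin_def)
    have ev: "\<forall>\<^sub>F i in F. m i \<in> Prob X"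
      using L \<mu> openin_topspace[of "weak_star X"] unfolding limitin_def by auto
    have "((\<lambda>i. \<integral>x. f x \<partial>(m i)) \<longlongrightarrow> (\<integral>x. f x \<partial>\<mu>)) F" if f: "continuous_map X euclideanreal f" for f
    proof (rule topological_tendstoI)
      fix S :: "real set" assume S: "open S" "(\<integral>x. f x \<partial>\<mu>) \<in> S"
      have "openin ?T {h \<in> topspace ?T. h f \<in> S}"
        using f S continuous_map_product_projection[of f ?C "\<lambda>_. euclideanreal"]
        by (auto simp: continuous_map_def simp del: topspace_product_topology)
      then have "openin (weak_star X) (?I -` {h \<in> topspace ?T. h f \<in> S} \<inter> Prob X)"
        unfolding weak_star_def openin_pullback_topology by blast
      moreover have "?I -` {h \<in> topspace ?T. h f \<in> S} \<inter> Prob X = {\<nu> \<in> Prob X. (\<integral>x. f x \<partial>\<nu>) \<in> S}"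
        using f by auto
      ultimately have "openin (weak_star X) {\<nu> \<in> Prob X. (\<integral>x. f x \<partial>\<nu>) \<in> S}" by simp
      then have "\<forall>\<^sub>F i in F. m i \<in> {\<nu> \<in> Prob X. (\<integral>x. f x \<partial>\<nu>) \<in> S}"
        using L S \<mu> unfolding limitin_def by blast
      then show "\<forall>\<^sub>F i in F. (\<integral>x. f x \<partial>(m i)) \<in> S"
        by (rule eventually_mono) auto
    qed
    then show ?R using \<mu> ev by blast
  next
    assume R: ?R
    have lim: "limitin ?T (\<lambda>i. ?I (m i)) (?I \<mu>) F"
      unfolding limitin_componentwise using R by (auto simp: limitin_canonical_iff)
    show ?L
      unfolding limitin_def
    proof (intro conjI allI impI)
      show "\<mu> \<in> topspace (weak_star X)" using R by simp
      fix U assume U: "openin (weak_star X) U \<and> \<mu> \<in> U"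
      then obtain V where V: "openin ?T V" "U = ?I -` V \<inter> Prob X"
        unfolding weak_star_def openin_pullback_topology by blast
      then have "\<forall>\<^sub>F i in F. ?I (m i) \<in> V" using lim U unfolding limitin_def by blast
      with R have "\<forall>\<^sub>F i in F. ?I (m i) \<in> V \<and> m i \<in> Prob X" by (simp add: eventually_conj)
      then show "\<forall>\<^sub>F i in F. m i \<in> U" by (rule eventually_mono) (use V in auto)
    qed
  }
qed

lemma distr_in_Prob:
  assumes f: "homeomorphic_map X Y f" and \<mu>: "\<mu> \<in> Prob X"
  shows "distr \<mu> (borel_of Y) f \<in> Prob Y"
proof -
  let ?\<nu> = "distr \<mu> (borel_of Y) f"
  obtain f' where f': "homeomorphic_maps X Y f f'" using f by (auto simp: homeomorphic_map_maps)
  then have cf: "continuous_map X Y f" and cf': "continuous_map Y X f'"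
    and inv: "\<And>x. x \<in> topspace X \<Longrightarrow> f' (f x) = x" "\<And>y. y \<in> topspace Y \<Longrightarrow> f (f' y) = y"
    and ty: "\<And>x. x \<in> topspace X \<Longrightarrow> f x \<in> topspace Y" "\<And>y. y \<in> topspace Y \<Longrightarrow> f' y \<in> topspace X"
    by (auto simp: homeomorphic_maps_def continuous_map_def)
  note P = ProbD[OF \<mu>]
  have mf: "f \<in> measurable \<mu> (borel_of Y)"
    using measurable_borel_of[OF cf] P(1) measurable_cong_sets by blast
  have em: "emeasure ?\<nu> A = emeasure \<mu> (f' ` A)" "f' ` A \<in> sets \<mu>" if A: "A \<in> sets (borel_of Y)" for A
  proof -
    have sub: "A \<subseteq> topspace Y" using sets.sets_into_space[OF A] by simp
    have eq: "f -` A \<inter> space \<mu> = f' ` A"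
      using sub ty inv by (auto simp: P(3) image_iff) (metis subsetD)
    show "emeasure ?\<nu> A = emeasure \<mu> (f' ` A)"
      using emeasure_distr[OF mf A] eq by simp
    show "f' ` A \<in> sets \<mu>" using measurable_sets[OF mf A] eq by simp
  qed
  have reg: "emeasure ?\<nu> A = (INF U\<in>{U. openin Y U \<and> A \<subseteq> U}. emeasure ?\<nu> U)"
            "emeasure ?\<nu> A = (SUP K\<in>{K. compactin Y K \<and> K \<in> sets ?\<nu> \<and> K \<subseteq> A}. emeasure ?\<nu> K)"
    if A: "A \<in> sets ?\<nu>" for A
  proof -
    have A': "A \<in> sets (borel_of Y)" using A by simp
    have sub: "A \<subseteq> topspace Y" using sets.sets_into_space[OF A'] by simp
    have opX: "openin X (f' ` U)" if "openin Y U" for U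
      using that f' homeomorphic_imp_open_map homeomorphic_maps_sym homeomorphic_maps_map
      unfolding open_map_def by meson
    have opY: "openin Y (f ` U)" if "openin X U" for U
      using that f homeomorphic_imp_open_map unfolding open_map_def by meson
    have ff': "f' ` f ` V = V" if "V \<subseteq> topspace X" for V
      using that inv by (force simp: image_iff)
    have f'f: "f ` f' ` V = V" if "V \<subseteq> topspace Y" for V
      using that inv by (force simp: image_iff)
    have "emeasure ?\<nu> A = emeasure \<mu> (f' ` A)" using em A' by blast
    also have "\<dots> = (INF U\<in>{U. openin X U \<and> f' ` A \<subseteq> U}. emeasure \<mu> U)"
      using \<mu> em(2)[OF A'] by (auto simp: Prob_def)
    also have "{U. openin X U \<and> f' ` A \<subseteq> U} = (`) f' ` {U. openin Y U \<and> A \<subseteq> U}"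
    proof (intro equalityI subsetI)
      fix U assume U: "U \<in> {U. openin X U \<and> f' ` A \<subseteq> U}"
      then have "f ` f' ` A \<subseteq> f ` U" by blast
      then have "A \<subseteq> f ` U" using f'f[OF sub] by simp
      moreover have "openin Y (f ` U)" "f' ` f ` U = U"
        using U opY ff' openin_subset[of X U] by auto
      ultimately have "f ` U \<in> {U. openin Y U \<and> A \<subseteq> U}" "U = f' ` f ` U" by auto
      then show "U \<in> (`) f' ` {U. openin Y U \<and> A \<subseteq> U}"
        by (rule rev_image_eqI)
    qed (use opX in auto)
    also have "(INF U\<in>(`) f' ` {U. openin Y U \<and> A \<subseteq> U}. emeasure \<mu> U)
       = (INF U\<in>{U. openin Y U \<and> A \<subseteq> U}. emeasure ?\<nu> U)"
      unfolding image_image by (intro INF_cong refl) (auto simp: em borel_of_openin)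
    finally show "emeasure ?\<nu> A = (INF U\<in>{U. openin Y U \<and> A \<subseteq> U}. emeasure ?\<nu> U)" .
    have "emeasure ?\<nu> A = emeasure \<mu> (f' ` A)" using em A' by blast
    also have "\<dots> = (SUP K\<in>{K. compactin X K \<and> K \<in> sets \<mu> \<and> K \<subseteq> f' ` A}. emeasure \<mu> K)"
      using \<mu> em(2)[OF A'] unfolding Prob_def by blast
    also have "{K. compactin X K \<and> K \<in> sets \<mu> \<and> K \<subseteq> f' ` A}
       = (`) f' ` {K. compactin Y K \<and> K \<in> sets ?\<nu> \<and> K \<subseteq> A}"
    proof (intro equalityI subsetI)
      fix K assume K: "K \<in> {K. compactin X K \<and> K \<in> sets \<mu> \<and> K \<subseteq> f' ` A}"
      then have KX: "K \<subseteq> topspace X" using compactin_subset_topspace by blast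
      have 1: "compactin Y (f ` K)" using K cf image_compactin by blast
      have "f ` K \<subseteq> f ` f' ` A" using K by blast
      then have 2: "f ` K \<subseteq> A" using f'f[OF sub] by simp
      have "f ` K = f' -` K \<inter> space (borel_of Y)"
        using KX ty inv by (auto simp: image_iff) (metis subsetD)
      then have 3: "f ` K \<in> sets ?\<nu>"
        using measurable_sets[OF measurable_borel_of[OF cf'], of K] K P(1) by simp
      have "f' ` f ` K = K" using KX ff' by blast
      with 1 2 3 show "K \<in> (`) f' ` {K. compactin Y K \<and> K \<in> sets ?\<nu> \<and> K \<subseteq> A}"
        by (metis (mono_tags, lifting) image_eqI mem_Collect_eq)
    qed (use cf' image_compactin em(2) in auto)
    also have "(SUP K\<in>(`) f' ` {K. compactin Y K \<and> K \<in> sets ?\<nu> \<and> K \<subseteq> A}. emeasure \<mu> K)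
       = (SUP K\<in>{K. compactin Y K \<and> K \<in> sets ?\<nu> \<and> K \<subseteq> A}. emeasure ?\<nu> K)"
      unfolding image_image by (intro SUP_cong refl) (auto simp: em)
    finally show "emeasure ?\<nu> A
       = (SUP K\<in>{K. compactin Y K \<and> K \<in> sets ?\<nu> \<and> K \<subseteq> A}. emeasure ?\<nu> K)" .
  qed
  have "prob_space ?\<nu>" using prob_space.prob_space_distr[OF P(2) mf] .
  then show ?thesis unfolding Prob_def using reg by auto
qed

lemma strongly_proximal_homeomorphic:
  assumes f: "homeomorphic_map X Z f" and sp: "strongly_proximal G X \<phi>"
    and \<phi>: "\<And>g. g \<in> carrier G \<Longrightarrow> homeomorphic_map X X (\<phi> g)"
    and \<zeta>: "\<And>g. g \<in> carrier G \<Longrightarrow> homeomorphic_map Z Z (\<zeta> g)"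
    and eq: "equivariant G X \<phi> \<zeta> f"
  shows "strongly_proximal G Z \<zeta>"
  unfolding strongly_proximal_def proximal_def topspace_weak_star
proof (intro ballI)
  fix \<mu> \<nu> assume \<mu>: "\<mu> \<in> Prob Z" and \<nu>: "\<nu> \<in> Prob Z"
  obtain f' where f': "homeomorphic_maps X Z f f'" using f by (auto simp: homeomorphic_map_maps)
  have hf': "homeomorphic_map Z X f'" using f' homeomorphic_maps_map homeomorphic_maps_sym by blast
  have cf: "continuous_map X Z f" and cf': "continuous_map Z X f'"
    and inv: "\<And>y. y \<in> topspace Z \<Longrightarrow> f (f' y) = y"
    using f' by (auto simp: homeomorphic_maps_def)
  let ?D = "\<lambda>\<mu>. distr \<mu> (borel_of X) f'"
  let ?L = "\<lambda>g \<mu>. distr \<mu> (borel_of X) (\<phi> g)"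
  let ?M = "\<lambda>g \<mu>. distr \<mu> (borel_of Z) (\<zeta> g)"
  have "?D \<mu> \<in> Prob X" "?D \<nu> \<in> Prob X" using \<mu> \<nu> hf' distr_in_Prob by blast+
  then obtain F \<rho> where F: "F \<noteq> bot" "\<forall>\<^sub>F g in F. g \<in> carrier G"
    and lim: "limitin (weak_star X) (\<lambda>g. ?L g (?D \<mu>)) \<rho> F" "limitin (weak_star X) (\<lambda>g. ?L g (?D \<nu>)) \<rho> F"
    using sp unfolding strongly_proximal_def proximal_def topspace_weak_star by meson
  have mf: "f \<in> measurable (borel_of X) (borel_of Z)" "f' \<in> measurable (borel_of Z) (borel_of X)"
    using measurable_borel_of cf cf' by auto
  have transfer: "limitin (weak_star Z) (\<lambda>g. ?M g \<mu>) (distr \<rho> (borel_of Z) f) F"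
    if \<mu>: "\<mu> \<in> Prob Z" and lim: "limitin (weak_star X) (\<lambda>g. ?L g (?D \<mu>)) \<rho> F" for \<mu>
    unfolding limitin_weak_star
  proof (intro conjI allI impI)
    have \<rho>: "\<rho> \<in> Prob X" using lim by (simp add: limitin_weak_star)
    show "distr \<rho> (borel_of Z) f \<in> Prob Z" using distr_in_Prob[OF f \<rho>] .
    show "\<forall>\<^sub>F g in F. ?M g \<mu> \<in> Prob Z"
      using F(2) by (rule eventually_mono) (use \<mu> \<zeta> distr_in_Prob in blast)
    fix h assume h: "continuous_map Z euclideanreal h"
    have hf: "continuous_map X euclideanreal (h \<circ> f)" using h cf continuous_map_compose by blast
    have mh: "h \<in> borel_measurable (borel_of Z)" using h measurable_borel_of_real by blast
    have \<rho>h: "(\<integral>x. h x \<partial>(distr \<rho> (borel_of Z) f)) = (\<integral>x. (h \<circ> f) x \<partial>\<rho>)"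
      using ProbD(1)[OF \<rho>] mf mh measurable_cong_sets[OF ProbD(1)[OF \<rho>] refl, of "borel_of Z"]
      by (simp add: integral_distr)
    have "((\<lambda>g. \<integral>x. (h \<circ> f) x \<partial>(?L g (?D \<mu>))) \<longlongrightarrow> (\<integral>x. (h \<circ> f) x \<partial>\<rho>)) F"
      using lim hf unfolding limitin_weak_star by blast
    moreover have "\<forall>\<^sub>F g in F. (\<integral>x. (h \<circ> f) x \<partial>(?L g (?D \<mu>))) = (\<integral>x. h x \<partial>(?M g \<mu>))"
      using F(2)
    proof (rule eventually_mono)
      fix g assume g: "g \<in> carrier G"
      have sm: "sets \<mu> = sets (borel_of Z)" and sp\<mu>: "space \<mu> = topspace Z" using ProbD[OF \<mu>] by auto
      have m\<phi>: "\<phi> g \<in> measurable (borel_of X) (borel_of X)"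
        using \<phi>[OF g] homeomorphic_imp_continuous_map measurable_borel_of by blast
      have m\<zeta>: "\<zeta> g \<in> measurable \<mu> (borel_of Z)"
        using \<zeta>[OF g] homeomorphic_imp_continuous_map measurable_borel_of
          measurable_cong_sets[OF sm refl, of "borel_of Z"] by blast
      have mf'\<mu>: "f' \<in> measurable \<mu> (borel_of X)"
        using mf measurable_cong_sets[OF sm refl, of "borel_of X"] by blast
      have "(\<integral>x. (h \<circ> f) x \<partial>(?L g (?D \<mu>))) = (\<integral>x. (h \<circ> f) (\<phi> g x) \<partial>(?D \<mu>))"
        using m\<phi> mh mf by (subst integral_distr) auto
      also have "\<dots> = (\<integral>x. (h \<circ> f) (\<phi> g (f' x)) \<partial>\<mu>)"
        using measurable_compose[OF measurable_compose[OF m\<phi> mf(1)] mh]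
        by (intro integral_distr[OF mf'\<mu>]) (simp add: o_def)
      also have "\<dots> = (\<integral>x. h (\<zeta> g x) \<partial>\<mu>)"
      proof (rule Bochner_Integration.integral_cong[OF refl])
        fix x assume "x \<in> space \<mu>"
        then have x: "x \<in> topspace Z" using sp\<mu> by simp
        then have "f' x \<in> topspace X" using cf' by (auto simp: continuous_map_def)
        then show "(h \<circ> f) (\<phi> g (f' x)) = h (\<zeta> g x)"
          using eq g inv[OF x] unfolding equivariant_def by auto
      qed
      also have "\<dots> = (\<integral>x. h x \<partial>(?M g \<mu>))"
        using integral_distr[OF m\<zeta> mh] by simp
      finally show "(\<integral>x. (h \<circ> f) x \<partial>(?L g (?D \<mu>))) = (\<integral>x. h x \<partial>(?M g \<mu>))" .
    qed
    ultimately show "((\<lambda>g. \<integral>x. h x \<partial>(?M g \<mu>)) \<longlongrightarrow> (\<integral>x. h x \<partial>(distr \<rho> (borel_of Z) f))) F"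
      unfolding \<rho>h by (rule Lim_transform_eventually)
  qed
  show "\<exists>F. F \<noteq> bot \<and> (\<forall>\<^sub>F g in F. g \<in> carrier G) \<and>
      (\<exists>z. limitin (weak_star Z) (\<lambda>g. ?M g \<mu>) z F \<and> limitin (weak_star Z) (\<lambda>g. ?M g \<nu>) z F)"
    using F transfer[OF \<mu> lim(1)] transfer[OF \<nu> lim(2)] by blast
qed

lemma boundary_transport:
  fixes X :: "'a topology" and f :: "'a \<Rightarrow> 'b"
  assumes bd: "boundary G X \<phi>" and inj: "inj_on f (topspace X)"
  shows "\<exists>Z \<zeta>. homeomorphic_map X Z f \<and> equivariant G X \<phi> \<zeta> f \<and> boundary G Z \<zeta>"
proof -
  define S where "S = f ` topspace X"
  define f' where "f' = inv_into (topspace X) f"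
  define Z where "Z = pullback_topology S f' X"
  define \<zeta> where "\<zeta> = (\<lambda>g. \<lambda>z\<in>S. f (\<phi> g (f' z)))"
  have cX: "compact_space X" and HX: "Hausdorff_space X" and ne: "topspace X \<noteq> {}"
    and ga: "group_action G (topspace X) \<phi>"
    and hm: "\<And>g. g \<in> carrier G \<Longrightarrow> homeomorphic_map X X (\<phi> g)"
    and mn: "minimal_action G X \<phi>" and sp: "strongly_proximal G X \<phi>"
    using bd by (auto simp: boundary_def action_by_homeos_def)
  interpret group_action G "topspace X" \<phi> by (rule ga)
  have grp: "group G" using group_hom group_hom.axioms(1) by blast
  have f'f: "f' (f x) = x" if "x \<in> topspace X" for x
    using that inj by (simp add: f'_def)
  have ff': "f (f' z) = z" "f' z \<in> topspace X" if "z \<in> S" for z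
    using that by (auto simp: f'_def S_def f_inv_into_f inv_into_into)
  have tZ: "topspace Z = S" using ff' by (auto simp: Z_def topspace_pullback_topology)
  have cf': "continuous_map Z X f'"
    using continuous_map_pullback[OF continuous_map_id, of S f' X] by (simp add: Z_def o_def)
  have "continuous_map X X (f' \<circ> f)"
    by (rule continuous_map_eq[OF continuous_map_id]) (simp add: f'f)
  then have cf: "continuous_map X Z f"
    unfolding Z_def by (rule continuous_map_pullback') (auto simp: S_def)
  have hms: "homeomorphic_maps X Z f f'"
    unfolding homeomorphic_maps_def using cf cf' f'f ff' tZ by auto
  then have hf: "homeomorphic_map X Z f" and hf': "homeomorphic_map Z X f'"
    using homeomorphic_maps_map homeomorphic_maps_sym by blast+
  have eq: "equivariant G X \<phi> \<zeta> f"
    by (auto simp: equivariant_def \<zeta>_def S_def f'f)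
  have mem: "\<phi> g x \<in> topspace X" if "g \<in> carrier G" "x \<in> topspace X" for g x
    using that element_image by blast
  have h\<zeta>: "homeomorphic_map Z Z (\<zeta> g)" if g: "g \<in> carrier G" for g
  proof -
    have "homeomorphic_map Z Z (f \<circ> (\<phi> g \<circ> f'))"
      by (rule homeomorphic_map_compose[OF homeomorphic_map_compose[OF hf' hm[OF g]] hf])
    then show ?thesis
      by (rule homeomorphic_map_eq) (simp add: \<zeta>_def tZ)
  qed
  have Bij: "\<zeta> g \<in> Bij S" if "g \<in> carrier G" for g
    using homeomorphic_eq_everything_map[of Z Z "\<zeta> g"] h\<zeta>[OF that] tZ
    by (simp add: Bij_def bij_betw_def) (simp add: \<zeta>_def)
  have "\<zeta> \<in> hom G (BijGroup S)"
  proof (rule homI)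
    fix g h assume gh: "g \<in> carrier G" "h \<in> carrier G"
    have "\<zeta> (g \<otimes>\<^bsub>G\<^esub> h) = compose S (\<zeta> g) (\<zeta> h)"
    proof
      fix z show "\<zeta> (g \<otimes>\<^bsub>G\<^esub> h) z = compose S (\<zeta> g) (\<zeta> h) z"
      proof (cases "z \<in> S")
        case True
        then have z: "f' z \<in> topspace X" using ff' by blast
        then have m: "\<phi> h (f' z) \<in> topspace X" using mem gh by blast
        have "\<zeta> h z = f (\<phi> h (f' z))" "f (\<phi> h (f' z)) \<in> S"
          using True m by (auto simp: \<zeta>_def S_def)
        then show ?thesis
          using True composition_rule[OF z gh] f'f[OF m] by (simp add: \<zeta>_def compose_def)
      qed (simp add: \<zeta>_def compose_def)
    qed
    then show "\<zeta> (g \<otimes>\<^bsub>G\<^esub> h) = \<zeta> g \<otimes>\<^bsub>BijGroup S\<^esub> \<zeta> h"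
      using Bij gh by (simp add: BijGroup_def)
  qed (simp add: BijGroup_def Bij)
  then have "group_action G (topspace Z) \<zeta>"
    using grp group_BijGroup tZ by (simp add: group_action_def group_hom_def group_hom_axioms_def)
  then have ah: "action_by_homeos G Z \<zeta>" using h\<zeta> by (simp add: action_by_homeos_def)
  have "minimal_action G Z \<zeta>"
    unfolding minimal_action_def
  proof (intro allI impI)
    fix C assume C: "closedin Z C \<and> (\<forall>g\<in>carrier G. \<zeta> g ` C \<subseteq> C)"
    then have CS: "C \<subseteq> S" using closedin_subset tZ by blast
    have cl: "closedin X (f' ` C)"
      using C hf' homeomorphic_imp_closed_map closed_map_def by blast
    have "\<phi> g ` f' ` C \<subseteq> f' ` C" if g: "g \<in> carrier G" for g
    proof
      fix y assume "y \<in> \<phi> g ` f' ` C"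
      then obtain c where c: "c \<in> C" "y = \<phi> g (f' c)" by blast
      have "\<zeta> g c \<in> C" using C g c by blast
      moreover have "f' (\<zeta> g c) = y"
        using c CS ff'(2) f'f[OF mem[OF g]] by (simp add: \<zeta>_def subset_iff)
      ultimately show "y \<in> f' ` C" by blast
    qed
    then have "f' ` C = {} \<or> f' ` C = topspace X"
      using mn[unfolded minimal_action_def, rule_format, of "f' ` C"] cl by blast
    then show "C = {} \<or> C = topspace Z"
    proof
      assume "f' ` C = topspace X"
      then have "f ` f' ` C = S" by (simp add: S_def)
      moreover have "f ` f' ` C = C" using CS ff'(1) by (simp add: image_image subset_iff)
      ultimately show ?thesis using tZ by simp
    qed simp
  qed
  moreover have "strongly_proximal G Z \<zeta>"
    using strongly_proximal_homeomorphic[OF hf sp hm h\<zeta> eq] .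
  moreover have "compact_space Z" "Hausdorff_space Z"
    using cX HX homeomorphic_map_imp_homeomorphic_space[OF hf] homeomorphic_compact_space[of X Z]
      homeomorphic_Hausdorff_space[of X Z] by simp_all
  moreover have "topspace Z \<noteq> {}" using ne tZ S_def by simp
  ultimately show ?thesis using hf eq ah unfolding boundary_def by blast
qed

text \<open>A point is determined by the traces of its neighbourhoods on a dense orbit.\<close>

lemma boundary_representation:
  fixes G :: "('g, 'm) monoid_scheme" and X :: "'a topology"
  assumes bd: "boundary G X \<phi>"
  shows "\<exists>(Z :: 'g set set topology) \<zeta> f.
    homeomorphic_map X Z f \<and> equivariant G X \<phi> \<zeta> f \<and> boundary G Z \<zeta>"
proof -
  have HX: "Hausdorff_space X" and ne: "topspace X \<noteq> {}"
    and ga: "group_action G (topspace X) \<phi>"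
    and hm: "\<And>g. g \<in> carrier G \<Longrightarrow> homeomorphic_map X X (\<phi> g)"
    and mn: "minimal_action G X \<phi>"
    using bd by (auto simp: boundary_def action_by_homeos_def)
  interpret group_action G "topspace X" \<phi> by (rule ga)
  have grp: "group G" using group_hom group_hom.axioms(1) by blast
  obtain x0 where x0: "x0 \<in> topspace X" using ne by blast
  define O0 where "O0 = (\<lambda>g. \<phi> g x0) ` carrier G"
  have mem: "\<phi> g x \<in> topspace X" if "g \<in> carrier G" "x \<in> topspace X" for g x
    using that element_image by blast
  have O0: "O0 \<subseteq> topspace X" "O0 \<noteq> {}"
    using mem x0 monoid.one_closed[OF group.is_monoid[OF grp]] by (auto simp: O0_def)
  have "\<phi> g ` (X closure_of O0) \<subseteq> X closure_of O0" if g: "g \<in> carrier G" for g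
  proof -
    have "\<phi> g ` (X closure_of O0) \<subseteq> X closure_of (\<phi> g ` O0)"
      using continuous_map_image_closure_subset[OF homeomorphic_imp_continuous_map[OF hm[OF g]]] .
    moreover have "\<phi> g ` O0 \<subseteq> O0"
    proof
      fix y assume "y \<in> \<phi> g ` O0"
      then obtain h where h: "h \<in> carrier G" "y = \<phi> g (\<phi> h x0)" by (auto simp: O0_def)
      then have "y = \<phi> (g \<otimes>\<^bsub>G\<^esub> h) x0" using composition_rule[OF x0 g] by simp
      then show "y \<in> O0" using h g grp by (auto simp: O0_def group.is_monoid monoid.m_closed)
    qed
    ultimately show ?thesis using closure_of_mono[of "\<phi> g ` O0" O0 X] by (meson order_trans)
  qed
  then have "X closure_of O0 = {} \<or> X closure_of O0 = topspace X"
    using mn closedin_closure_of[of X O0] unfolding minimal_action_def by simp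
  moreover have "O0 \<subseteq> X closure_of O0" using closure_of_subset[OF O0(1)] .
  ultimately have dense: "X closure_of O0 = topspace X" using O0 by blast
  define f where "f = (\<lambda>x. {{g \<in> carrier G. \<phi> g x0 \<in> U} | U. openin X U \<and> x \<in> U})"
  have "inj_on f (topspace X)"
  proof (rule inj_onI, rule ccontr)
    fix x y assume xy: "x \<in> topspace X" "y \<in> topspace X" "f x = f y" "x \<noteq> y"
    then obtain U V where UV: "openin X U" "openin X V" "x \<in> U" "y \<in> V" "disjnt U V"
      using HX unfolding Hausdorff_space_def by metis
    have "{g \<in> carrier G. \<phi> g x0 \<in> U} \<in> f y" using UV xy(3) by (auto simp: f_def)
    then obtain W where W: "openin X W" "y \<in> W"
      "{g \<in> carrier G. \<phi> g x0 \<in> U} = {g \<in> carrier G. \<phi> g x0 \<in> W}" by (auto simp: f_def)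
    have "openin X (W \<inter> V)" "y \<in> W \<inter> V" using W UV by auto
    moreover have "y \<in> X closure_of O0" using dense xy(2) by simp
    ultimately obtain z where "z \<in> O0" "z \<in> W \<inter> V"
      unfolding in_closure_of by meson
    then show False using W(3) UV(5) by (auto simp: O0_def disjnt_def)
  qed
  from boundary_transport[OF bd this] show ?thesis by blast
qed

lemma equivariant_image_homeomorphic:
  assumes im: "equivariant_image G X \<phi> Z \<zeta>"
    and h: "homeomorphic_map Y Z f" "equivariant G Y \<eta> \<zeta> f" "action_by_homeos G Y \<eta>"
  shows "equivariant_image G X \<phi> Y \<eta>"
proof -
  obtain p where p: "continuous_map X Z p" "p ` topspace X = topspace Z" "equivariant G X \<phi> \<zeta> p"
    using im by (auto simp: equivariant_image_def)
  obtain f' where f': "homeomorphic_maps Y Z f f'" using h by (auto simp: homeomorphic_map_maps)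
  then have hf': "homeomorphic_map Z Y f'" using homeomorphic_maps_map homeomorphic_maps_sym by blast
  have inv: "\<And>y. y \<in> topspace Y \<Longrightarrow> f' (f y) = y" "\<And>z. z \<in> topspace Z \<Longrightarrow> f (f' z) = z"
    and ty: "\<And>z. z \<in> topspace Z \<Longrightarrow> f' z \<in> topspace Y"
    using f' by (auto simp: homeomorphic_maps_def continuous_map_def)
  have "continuous_map X Y (f' \<circ> p)"
    by (rule continuous_map_compose[OF p(1) homeomorphic_imp_continuous_map[OF hf']])
  moreover have "(f' \<circ> p) ` topspace X = topspace Y"
    using p(2) hf' homeomorphic_imp_surjective_map by (metis image_comp)
  moreover have "equivariant G X \<phi> \<eta> (f' \<circ> p)"
    unfolding equivariant_def
  proof (intro ballI)
    fix g x assume g: "g \<in> carrier G" and x: "x \<in> topspace X"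
    have px: "p x \<in> topspace Z" using p(2) x by blast
    have m: "\<eta> g (f' (p x)) \<in> topspace Y"
      using h(3) g ty[OF px] group_action.element_image unfolding action_by_homeos_def by fastforce
    have "p (\<phi> g x) = \<zeta> g (f (f' (p x)))" using p(3) g x inv(2)[OF px] by (simp add: equivariant_def)
    also have "\<dots> = f (\<eta> g (f' (p x)))" using h(2) g ty[OF px] by (simp add: equivariant_def)
    finally show "(f' \<circ> p) (\<phi> g x) = \<eta> g ((f' \<circ> p) x)" using inv(1)[OF m] by simp
  qed
  ultimately show ?thesis unfolding equivariant_image_def by blast
qed

lemma furstenberg_boundary_universal:
  assumes "furstenberg_boundary G X \<phi>" and "boundary G Y \<eta>"
  shows "equivariant_image G X \<phi> Y \<eta>"
proof -
  obtain Z \<zeta> f where Z: "homeomorphic_map Y Z f" "equivariant G Y \<eta> \<zeta> f"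
      "boundary G (Z :: 'a set set topology) \<zeta>"
    using boundary_representation[OF assms(2)] by blast
  then show ?thesis
    using assms equivariant_image_homeomorphic[OF _ Z(1,2)]
    by (auto simp: furstenberg_boundary_def boundary_def)
qed

lemma relative_boundary_universal:
  assumes "\<Lambda> \<subseteq> carrier \<Gamma>" and "relative_boundary \<Gamma> \<Lambda> X \<phi>"
    and "boundary \<Gamma> Y \<eta>" and "strongly_proximal (\<Gamma>\<lparr>carrier := \<Lambda>\<rparr>) Y \<eta>"
  shows "equivariant_image \<Gamma> X \<phi> Y \<eta>"
proof -
  obtain Z \<zeta> f where Z: "homeomorphic_map Y Z f" "equivariant \<Gamma> Y \<eta> \<zeta> f"
      "boundary \<Gamma> (Z :: 'a set set topology) \<zeta>"
    using boundary_representation[OF assms(3)] by blast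
  have "strongly_proximal (\<Gamma>\<lparr>carrier := \<Lambda>\<rparr>) Z \<zeta>"
    by (rule strongly_proximal_homeomorphic[OF Z(1) assms(4)])
      (use assms(1,3) Z in \<open>auto simp: boundary_def action_by_homeos_def equivariant_def\<close>)
  then have "equivariant_image \<Gamma> X \<phi> Z \<zeta>"
    using assms(2) Z(3) by (auto simp: relative_boundary_def)
  then show ?thesis
    using equivariant_image_homeomorphic[OF _ Z(1,2)] assms(3) by (auto simp: boundary_def)
qed

end

theory Submission
  imports Defs
begin

text \<open>
  Proximality of a group \<open>G\<close> on a compact space yields a smallest nonempty closed invariant set
  \<open>M\<close>, and every finite set of points can be moved by a single group element into a given
  neighbourhood of a given point of \<open>M\<close>.  Applying this to the translates of one point by coset
  representatives of a finite index subgroup shows that \<open>M\<close> lies in every nonempty closed set that is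
  invariant under that subgroup only.  For the commensurated subgroup \<open>\<Lambda>\<close> acting on \<open>B(\<Gamma>,\<Lambda>)\<close>, the set
  \<open>g M\<close> is invariant under \<open>\<Lambda> \<inter> g\<Lambda>g\<^sup>-\<^sup>1\<close>, so \<open>M \<subseteq> g M\<close> for all \<open>g\<close>; thus \<open>M\<close> is
  \<open>\<Gamma>\<close>-invariant, hence everything, and \<open>B(\<Gamma>,\<Lambda>)\<close> is a \<open>\<Lambda>\<close>-boundary.  The two universal properties give
  maps in both directions, and the composite self-map of \<open>\<partial>\<^sub>F\<Lambda>\<close> is the identity, because
  equivariant maps from a minimal action to a proximal one are unique.
\<close>

section \<open>Cluster points and separation by real functions\<close>

text \<open>Without a cluster point, every point has an open neighbourhood that \<open>m\<close>
  eventually avoids; finitely many of these cover the space, so \<open>m\<close> would eventually be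
  nowhere. A cluster point replaces the choice of a convergent subnet.\<close>

lemma compact_space_cluster_point:
  assumes X: "compact_space X" and F: "F \<noteq> bot" "\<forall>\<^sub>F i in F. m i \<in> topspace X"
  obtains a where "a \<in> topspace X" "\<And>U. openin X U \<Longrightarrow> a \<in> U \<Longrightarrow> \<exists>\<^sub>F i in F. m i \<in> U"
proof (rule ccontr)
  assume no: "\<not> thesis"
  define \<U> where "\<U> = {U. openin X U \<and> (\<forall>\<^sub>F i in F. m i \<notin> U)}"
  have "topspace X \<subseteq> \<Union>\<U>"
  proof (rule ccontr)
    assume "\<not> topspace X \<subseteq> \<Union>\<U>"
    then obtain a where a: "a \<in> topspace X" "a \<notin> \<Union>\<U>" by blast
    then have "\<exists>\<^sub>F i in F. m i \<in> U" if "openin X U" "a \<in> U" for U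
      using that by (auto simp: \<U>_def frequently_def)
    then show False using that a(1) no by blast
  qed
  then obtain \<F> where \<F>: "finite \<F>" "\<F> \<subseteq> \<U>" "topspace X \<subseteq> \<Union>\<F>"
    using X unfolding compact_space_alt \<U>_def by (metis (no_types, lifting) mem_Collect_eq)
  have "\<forall>\<^sub>F i in F. \<forall>U\<in>\<F>. m i \<notin> U"
    using \<F> by (intro eventually_ball_finite) (auto simp: \<U>_def)
  with F(2) have "\<forall>\<^sub>F i in F. False"
    by eventually_elim (use \<F> in blast)
  then show False using F(1) by (simp add: trivial_limit_def)
qed

text \<open>Urysohn's lemma in a compact Hausdorff, hence normal, space. Weak* limits only control
  integrals of continuous functions, and this turns such information back into equality of
  points.\<close>

lemma separated_by_real_function:
  assumes "compact_space X" "Hausdorff_space X" "a \<in> topspace X" "b \<in> topspace X"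
    and eq: "\<And>f. continuous_map X euclideanreal f \<Longrightarrow> f a = f b"
  shows "a = b"
proof (rule ccontr)
  assume "a \<noteq> b"
  moreover have "closedin X {a}" "closedin X {b}"
    using assms by (simp_all add: closedin_Hausdorff_sing_eq)
  moreover have "normal_space X"
    using assms compact_Hausdorff_or_regular_imp_normal_space by blast
  ultimately obtain f where "continuous_map X (top_of_set {0..1::real}) f" "f ` {a} \<subseteq> {0}" "f ` {b} \<subseteq> {1}"
    using Urysohn_lemma[of X "{a}" "{b}" 0 1] by (auto simp: disjnt_def)
  then show False
    using eq[of f] continuous_map_into_fulltopology by fastforce
qed

section \<open>Point masses and the contraction of pairs\<close>

text \<open>Regularity has explicit witnesses. From outside, use the whole space if
  \<open>x \<in> A\<close> and the complement of \<open>x\<close> otherwise; from inside, use the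
  compact set \<open>{x}\<close> if \<open>x \<in> A\<close>, while otherwise the measure of
  \<open>A\<close> is 0.\<close>

lemma return_in_Prob:
  assumes X: "Hausdorff_space X" and x: "x \<in> topspace X"
  shows "return (borel_of X) x \<in> Prob X"
proof -
  let ?\<delta> = "return (borel_of X) x"
  have op: "openin X (topspace X - {x})" and cl: "closedin X {x}"
    using X x by (simp_all add: closedin_Hausdorff_sing_eq openin_diff)
  have sx: "{x} \<in> sets (borel_of X)"
    using sets.compl_sets[OF borel_of_openin[OF op]] x by (simp add: double_diff)
  have em: "emeasure ?\<delta> A = indicator A x" if "A \<in> sets (borel_of X)" for A
    using that by simp
  have "emeasure ?\<delta> A = (INF U\<in>{U. openin X U \<and> A \<subseteq> U}. emeasure ?\<delta> U)" (is "_ = ?I")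
    and "emeasure ?\<delta> A = (SUP K\<in>{K. compactin X K \<and> K \<in> sets ?\<delta> \<and> K \<subseteq> A}. emeasure ?\<delta> K)" (is "_ = ?S")
    if A: "A \<in> sets ?\<delta>" for A
  proof -
    have sub: "A \<subseteq> topspace X" using sets.sets_into_space[OF A] by simp
    have "?I \<le> emeasure ?\<delta> A"
    proof (cases "x \<in> A")
      case True
      then have "emeasure ?\<delta> (topspace X) \<le> emeasure ?\<delta> A"
        using A x em[OF borel_of_openin[OF openin_topspace]] by simp
      then show ?thesis
        by (rule INF_lower2[rotated]) (use sub in auto)
    next
      case False
      then have "emeasure ?\<delta> (topspace X - {x}) \<le> emeasure ?\<delta> A"
        using em[OF borel_of_openin[OF op]] by simp
      then show ?thesis
        by (rule INF_lower2[rotated]) (use sub False op in auto)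
    qed
    moreover have "emeasure ?\<delta> A \<le> ?I"
      by (intro INF_greatest emeasure_mono) (auto simp: borel_of_openin)
    ultimately show "emeasure ?\<delta> A = ?I" by (rule antisym[rotated])
    have "emeasure ?\<delta> A \<le> ?S"
    proof (cases "x \<in> A")
      case True
      then have "emeasure ?\<delta> A \<le> emeasure ?\<delta> {x}" using em[OF sx] A by simp
      then show ?thesis
        by (rule SUP_upper2[rotated]) (use True x sx in simp)
    qed (use A in simp)
    moreover have "?S \<le> emeasure ?\<delta> A"
      by (intro SUP_least emeasure_mono) (use A in auto)
    ultimately show "emeasure ?\<delta> A = ?S" by (rule antisym)
  qed
  moreover have "prob_space ?\<delta>" using x by (simp add: prob_space_return)
  ultimately show ?thesis unfolding Prob_def using sets_return[of "borel_of X" x] by blast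
qed

text \<open>Strong proximality is applied to the point masses at \<open>x\<close> and
  \<open>y\<close>, which are pushed forward to the point masses at \<open>\<phi> g x\<close> and
  \<open>\<phi> g y\<close>. Their common limit \<open>\<rho>\<close> is not known in advance to be
  a point mass, so a cluster point \<open>(a, b)\<close> of the pairs is taken in the compact
  square. Every continuous function takes the value of its \<open>\<rho>\<close>-integral at both
  \<open>a\<close> and \<open>b\<close>, hence \<open>a = b\<close>.\<close>

lemma strongly_proximal_contracts_pairs:
  assumes X: "compact_space X" "Hausdorff_space X"
    and \<phi>: "\<And>g. g \<in> carrier G \<Longrightarrow> homeomorphic_map X X (\<phi> g)"
    and sp: "strongly_proximal G X \<phi>"
    and xy: "x \<in> topspace X" "y \<in> topspace X"
  shows "\<exists>z\<in>topspace X. \<forall>U. openin X U \<and> z \<in> U \<longrightarrow> (\<exists>g\<in>carrier G. \<phi> g x \<in> U \<and> \<phi> g y \<in> U)"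
proof -
  let ?\<delta> = "\<lambda>x. return (borel_of X) x"
  obtain F \<rho> where F: "F \<noteq> bot" "\<forall>\<^sub>F g in F. g \<in> carrier G"
    and lim: "limitin (weak_star X) (\<lambda>g. distr (?\<delta> x) (borel_of X) (\<phi> g)) \<rho> F"
      "limitin (weak_star X) (\<lambda>g. distr (?\<delta> y) (borel_of X) (\<phi> g)) \<rho> F"
    using sp return_in_Prob[OF X(2) xy(1)] return_in_Prob[OF X(2) xy(2)]
    unfolding strongly_proximal_def proximal_def topspace_weak_star by meson
  have cont: "continuous_map X X (\<phi> g)" if "g \<in> carrier G" for g
    using \<phi>[OF that] homeomorphic_imp_continuous_map by blast
  have mem: "\<phi> g w \<in> topspace X" if "g \<in> carrier G" "w \<in> topspace X" for g w
    using cont[OF that(1)] that(2) by (auto simp: continuous_map_def)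
  have tends: "((\<lambda>g. f (\<phi> g w)) \<longlongrightarrow> (\<integral>u. f u \<partial>\<rho>)) F"
    if w: "w \<in> topspace X" and l: "limitin (weak_star X) (\<lambda>g. distr (?\<delta> w) (borel_of X) (\<phi> g)) \<rho> F"
      and f: "continuous_map X euclideanreal f" for w f
  proof (rule Lim_transform_eventually)
    show "((\<lambda>g. \<integral>u. f u \<partial>(distr (?\<delta> w) (borel_of X) (\<phi> g))) \<longlongrightarrow> (\<integral>u. f u \<partial>\<rho>)) F"
      using l f by (simp add: limitin_weak_star)
    show "\<forall>\<^sub>F g in F. (\<integral>u. f u \<partial>(distr (?\<delta> w) (borel_of X) (\<phi> g))) = f (\<phi> g w)"
      using F(2)
    proof eventually_elim
      case (elim g)
      then have "distr (?\<delta> w) (borel_of X) (\<phi> g) = ?\<delta> (\<phi> g w)"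
        using measurable_borel_of[OF cont] w by (intro distr_return) auto
      then show ?case
        using measurable_borel_of_real[OF f] mem[OF elim w] by (simp add: integral_return)
    qed
  qed
  have "\<forall>\<^sub>F g in F. (\<phi> g x, \<phi> g y) \<in> topspace (prod_topology X X)"
    using F(2) by eventually_elim (use mem xy in auto)
  then obtain ab where ab: "ab \<in> topspace (prod_topology X X)"
    and clus: "\<And>U. openin (prod_topology X X) U \<Longrightarrow> ab \<in> U \<Longrightarrow> \<exists>\<^sub>F g in F. (\<phi> g x, \<phi> g y) \<in> U"
    using compact_space_cluster_point[of "prod_topology X X" F "\<lambda>g. (\<phi> g x, \<phi> g y)"] X F(1)
    by (auto simp: compact_space_prod_topology)
  obtain a b where [simp]: "ab = (a, b)" by (cases ab)
  have a: "a \<in> topspace X" and b: "b \<in> topspace X" using ab by auto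
  have clus2: "\<exists>\<^sub>F g in F. \<phi> g x \<in> U \<and> \<phi> g y \<in> V" if "openin X U" "a \<in> U" "openin X V" "b \<in> V" for U V
    using clus[of "U \<times> V"] that by (simp add: openin_prod_Times_iff)
  have val: "f a = (\<integral>u. f u \<partial>\<rho>) \<and> f b = (\<integral>u. f u \<partial>\<rho>)" if f: "continuous_map X euclideanreal f" for f
  proof (rule ccontr)
    let ?c = "\<integral>u. f u \<partial>\<rho>"
    assume no: "\<not> (f a = ?c \<and> f b = ?c)"
    obtain S where S: "open S" "?c \<in> S" "f a \<notin> closure S \<or> f b \<notin> closure S"
    proof -
      \<comment> \<open>The radius is half the larger of the two distances, so the closed ball
        misses whichever of \<open>f a\<close>, \<open>f b\<close> lies farther from
        \<open>?c\<close>.\<close>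
      define e where "e = max (dist (f a) ?c) (dist (f b) ?c)"
      have "e > 0" using no by (auto simp: e_def less_max_iff_disj)
      moreover have "closure (ball ?c (e/2)) \<subseteq> cball ?c (e/2)" by (rule closure_minimal[OF ball_subset_cball closed_cball])
      ultimately show ?thesis
        by (intro that[of "ball ?c (e/2)"])
          (auto simp: e_def max_def dist_commute split: if_splits)
    qed
    have op: "openin X {u \<in> topspace X. f u \<in> - closure S}"
      using f by (rule openin_continuous_map_preimage) (simp add: open_Compl)
    \<comment> \<open>Clustering at \<open>(a, b)\<close> puts one of the two values outside
      \<open>closure S\<close> frequently, whereas convergence of the integrals puts both into
      \<open>S\<close> eventually.\<close>
    have "\<exists>\<^sub>F g in F. f (\<phi> g x) \<notin> closure S \<or> f (\<phi> g y) \<notin> closure S"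
      using S(3)
    proof
      assume "f a \<notin> closure S"
      then show ?thesis
        using clus2[OF op _ openin_topspace b] a by (auto elim: frequently_elim1)
    next
      assume "f b \<notin> closure S"
      then show ?thesis
        using clus2[OF openin_topspace a op] b by (auto elim: frequently_elim1)
    qed
    moreover have "\<forall>\<^sub>F g in F. f (\<phi> g x) \<in> S \<and> f (\<phi> g y) \<in> S"
      using topological_tendstoD[OF tends[OF xy(1) lim(1) f] S(1,2)]
        topological_tendstoD[OF tends[OF xy(2) lim(2) f] S(1,2)]
      by (rule eventually_conj)
    then have "\<forall>\<^sub>F g in F. \<not> (f (\<phi> g x) \<notin> closure S \<or> f (\<phi> g y) \<notin> closure S)"
      by eventually_elim (use closure_subset in blast)
    ultimately show False by (simp add: frequently_def)
  qed
  have "a = b" by (rule separated_by_real_function[OF X a b]) (use val in force)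
  have "\<exists>g\<in>carrier G. \<phi> g x \<in> U \<and> \<phi> g y \<in> U" if "openin X U" "a \<in> U" for U
  proof -
    have "\<exists>\<^sub>F g in F. g \<in> carrier G \<and> \<phi> g x \<in> U \<and> \<phi> g y \<in> U"
      using clus2[of U U] that F(2) \<open>a = b\<close> by (simp add: frequently_eventually_conj)
    then show ?thesis by (auto dest: frequently_ex)
  qed
  then show ?thesis using a by blast
qed

section \<open>Rigidity of equivariant maps\<close>

text \<open>The set where \<open>p\<close> and \<open>q\<close> agree is closed and invariant, so by
  minimality it only has to be nonempty. Contraction of the pair \<open>p x\<close>,
  \<open>q x\<close> towards some \<open>z\<close> brings both images of a suitable
  \<open>\<phi> g x\<close> near \<open>z\<close>, and compactness of \<open>X\<close> then gives a
  point that both maps send to \<open>z\<close>.\<close>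

lemma equivariant_maps_equal:
  assumes X: "compact_space X" "topspace X \<noteq> {}" "minimal_action G X \<phi>"
      "\<And>g x. g \<in> carrier G \<Longrightarrow> x \<in> topspace X \<Longrightarrow> \<phi> g x \<in> topspace X"
    and Y: "Hausdorff_space Y"
      "\<And>x y. x \<in> topspace Y \<Longrightarrow> y \<in> topspace Y \<Longrightarrow> \<exists>z\<in>topspace Y.
         \<forall>U. openin Y U \<and> z \<in> U \<longrightarrow> (\<exists>g\<in>carrier G. \<eta> g x \<in> U \<and> \<eta> g y \<in> U)"
    and p: "continuous_map X Y p" "equivariant G X \<phi> \<eta> p"
    and q: "continuous_map X Y q" "equivariant G X \<phi> \<eta> q"
    and x: "x \<in> topspace X"
  shows "p x = q x"
proof -
  let ?E = "{x \<in> topspace X. p x = q x}"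
  have ty: "p w \<in> topspace Y" "q w \<in> topspace Y" if "w \<in> topspace X" for w
    using that p(1) q(1) by (auto simp: continuous_map_def)
  obtain z where z: "z \<in> topspace Y"
    and near: "\<And>U. openin Y U \<Longrightarrow> z \<in> U \<Longrightarrow> \<exists>g\<in>carrier G. p (\<phi> g x) \<in> U \<and> q (\<phi> g x) \<in> U"
    using Y(2)[OF ty[OF x]] p(2) q(2) x unfolding equivariant_def by fastforce
  have "?E \<noteq> {}"
  proof
    assume E: "?E = {}"
    \<comment> \<open>A member of \<open>\<U>\<close> is an open set on which \<open>p\<close> and
      \<open>q\<close> never lie together in a certain neighbourhood of \<open>z\<close>. If the
      maps never agree, at each point one of them misses \<open>z\<close>, and Hausdorff separation
      provides such a set.\<close>
    define \<U> where "\<U> = {N. openin X N \<and> (\<exists>W. openin Y W \<and> z \<in> W \<and> (\<forall>w\<in>N. p w \<notin> W \<or> q w \<notin> W))}"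
    have "w \<in> \<Union>\<U>" if w: "w \<in> topspace X" for w
    proof -
      have sep: "\<exists>N\<in>\<U>. w \<in> N" if r: "continuous_map X Y r" "r w \<noteq> z" "r \<in> {p, q}" for r
      proof -
        have "r w \<in> topspace Y" using ty[OF w] r(3) by auto
        then obtain V W where VW: "openin Y V" "openin Y W" "r w \<in> V" "z \<in> W" "disjnt V W"
          using Y(1) z r(2) unfolding Hausdorff_space_def by metis
        have op: "openin X {u \<in> topspace X. r u \<in> V}"
          using openin_continuous_map_preimage[OF r(1) VW(1)] .
        have avoid: "\<forall>u\<in>{u \<in> topspace X. r u \<in> V}. p u \<notin> W \<or> q u \<notin> W"
        proof
          fix u assume "u \<in> {u \<in> topspace X. r u \<in> V}"
          then have "r u \<notin> W" using VW(5) by (simp add: disjnt_iff)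
          then show "p u \<notin> W \<or> q u \<notin> W" using r(3) by auto
        qed
        have "{u \<in> topspace X. r u \<in> V} \<in> \<U>"
          unfolding \<U>_def using op avoid VW(2,4) by (intro CollectI conjI exI[of _ W])
        then show ?thesis by (rule bexI[rotated]) (use VW(3) w in simp)
      qed
      have "p w \<noteq> z \<or> q w \<noteq> z" using E w by auto
      then show ?thesis using sep[of p] sep[of q] p(1) q(1) by blast
    qed
    then obtain \<F> where \<F>: "finite \<F>" "\<F> \<subseteq> \<U>" "topspace X \<subseteq> \<Union>\<F>"
      using X(1) unfolding compact_space_alt \<U>_def
      by (metis (no_types, lifting) mem_Collect_eq subsetI)
    then obtain W where W: "\<And>N. N \<in> \<F> \<Longrightarrow> openin Y (W N) \<and> z \<in> W N \<and> (\<forall>w\<in>N. p w \<notin> W N \<or> q w \<notin> W N)"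
      unfolding \<U>_def by (simp add: subset_eq) metis
    \<comment> \<open>The finitely many chosen neighbourhoods intersect in a neighbourhood of
      \<open>z\<close>. Some \<open>g\<close> sends both images of \<open>x\<close> into it,
      although \<open>\<phi> g x\<close> lies in a member of the finite cover.\<close>
    have op: "openin Y (topspace Y \<inter> \<Inter>(W ` \<F>))"
      using \<F>(1) W by (intro openin_Int_Inter) auto
    have "z \<in> topspace Y \<inter> \<Inter>(W ` \<F>)" using z W by auto
    then obtain g where g: "g \<in> carrier G" "p (\<phi> g x) \<in> \<Inter>(W ` \<F>)" "q (\<phi> g x) \<in> \<Inter>(W ` \<F>)"
      using near[OF op] unfolding Int_iff by meson
    then obtain N where "N \<in> \<F>" "\<phi> g x \<in> N" using \<F>(3) X(4)[OF g(1) x] by blast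
    then show False using W g by blast
  qed
  moreover have "closedin X ?E" using closedin_continuous_maps_eq[OF Y(1) p(1) q(1)] .
  moreover have "\<forall>g\<in>carrier G. \<phi> g ` ?E \<subseteq> ?E"
    using p(2) q(2) X(4) unfolding equivariant_def by auto
  ultimately have "?E = topspace X" using X(3) unfolding minimal_action_def by blast
  then show ?thesis using x by blast
qed

section \<open>The smallest closed invariant set of a proximal action\<close>

text \<open>Pair contraction is phrased by neighbourhoods, the form obtained from point masses. The
  instance needed later is \<open>\<Lambda>\<close> acting on
  \<open>B(\<Gamma>,\<Lambda>)\<close>.\<close>

locale proximal_flow =
  fixes G :: "('g, 'm) monoid_scheme" (structure) and X :: "'a topology" and \<phi> :: "'g \<Rightarrow> 'a \<Rightarrow> 'a"
  assumes action: "action_by_homeos G X \<phi>"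
    and compact: "compact_space X" and nonempty: "topspace X \<noteq> {}"
    and contracts_pairs: "\<And>x y. x \<in> topspace X \<Longrightarrow> y \<in> topspace X \<Longrightarrow> \<exists>z\<in>topspace X.
      \<forall>U. openin X U \<and> z \<in> U \<longrightarrow> (\<exists>g\<in>carrier G. \<phi> g x \<in> U \<and> \<phi> g y \<in> U)"

sublocale proximal_flow \<subseteq> group_action G "topspace X" \<phi>
  using action by (simp add: action_by_homeos_def)

context proximal_flow
begin

lemma group_G: "group G"
  using group_hom group_hom.axioms(1) by blast

lemma continuous_action: "g \<in> carrier G \<Longrightarrow> continuous_map X X (\<phi> g)"
  using action homeomorphic_imp_continuous_map by (auto simp: action_by_homeos_def)

lemma action_closed: "g \<in> carrier G \<Longrightarrow> x \<in> topspace X \<Longrightarrow> \<phi> g x \<in> topspace X"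
  using element_image by blast

lemma openin_translate:
  "g \<in> carrier G \<Longrightarrow> openin X U \<Longrightarrow> openin X {x \<in> topspace X. \<phi> g x \<in> U}"
  using openin_continuous_map_preimage[OF continuous_action] by blast

definition closed_invariant :: "'a set \<Rightarrow> bool" where
  "closed_invariant C \<longleftrightarrow> closedin X C \<and> C \<noteq> {} \<and> (\<forall>g\<in>carrier G. \<phi> g ` C \<subseteq> C)"

definition minimal_set :: "'a set" where
  "minimal_set = \<Inter>{C. closed_invariant C}"

lemma closed_invariant_topspace: "closed_invariant (topspace X)"
  using nonempty action_closed by (auto simp: closed_invariant_def)

text \<open>If \<open>x \<in> A\<close> and \<open>y \<in> B\<close> contract towards
  \<open>z\<close>, then \<open>z\<close> is a limit of translates of \<open>x\<close> inside
  \<open>A\<close> and of translates of \<open>y\<close> inside \<open>B\<close>, so it lies in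
  both.\<close>

lemma closed_invariant_Int:
  assumes A: "closed_invariant A" and B: "closed_invariant B"
  shows "closed_invariant (A \<inter> B)"
proof -
  obtain x y where xy: "x \<in> A" "y \<in> B" using A B by (auto simp: closed_invariant_def)
  then have xyX: "x \<in> topspace X" "y \<in> topspace X"
    using A B closedin_subset by (auto simp: closed_invariant_def)
  then obtain z where z: "z \<in> topspace X"
    and near: "\<And>U. openin X U \<Longrightarrow> z \<in> U \<Longrightarrow> \<exists>g\<in>carrier G. \<phi> g x \<in> U \<and> \<phi> g y \<in> U"
    using contracts_pairs[OF xyX] by meson
  have "z \<in> A"
    using near[of "topspace X - A"] A xy z by (fastforce simp: closed_invariant_def openin_diff)
  moreover have "z \<in> B"
    using near[of "topspace X - B"] B xy z by (fastforce simp: closed_invariant_def openin_diff)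
  ultimately have "A \<inter> B \<noteq> {}" by blast
  then show ?thesis using A B unfolding closed_invariant_def image_subset_iff by blast
qed

lemma closed_invariant_minimal_set: "closed_invariant minimal_set"
proof -
  \<comment> \<open>The factor \<open>topspace X\<close> handles the empty family, whose
    intersection is \<open>UNIV\<close>; it is dropped again before the finite intersection property
    is applied.\<close>
  have "closed_invariant (topspace X \<inter> \<Inter>\<F>)" if "finite \<F>" "\<F> \<subseteq> {C. closed_invariant C}" for \<F>
    using that
  proof (induction \<F> rule: finite_induct)
    case empty
    then show ?case by (simp add: closed_invariant_topspace)
  next
    case (insert A \<F>)
    then have "closed_invariant (A \<inter> (topspace X \<inter> \<Inter>\<F>))"
      using closed_invariant_Int[of A "topspace X \<inter> \<Inter>\<F>"] by auto
    then show ?case by (simp only: Inter_insert Int_left_commute)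
  qed
  then have "topspace X \<inter> \<Inter>\<F> \<noteq> {}" if "finite \<F>" "\<F> \<subseteq> {C. closed_invariant C}" for \<F>
    using that unfolding closed_invariant_def by blast
  then have "\<Inter>\<F> \<noteq> {}" if "finite \<F>" "\<F> \<subseteq> {C. closed_invariant C}" for \<F>
    using that by (metis Int_empty_right)
  moreover have "\<forall>C\<in>{C. closed_invariant C}. closedin X C" by (simp add: closed_invariant_def)
  ultimately have "\<Inter>{C. closed_invariant C} \<noteq> {}"
    using compact[unfolded compact_space_fip, rule_format, of "{C. closed_invariant C}"] by simp
  moreover have "closedin X (\<Inter>{C. closed_invariant C})"
    using closed_invariant_topspace by (intro closedin_Inter) (auto simp: closed_invariant_def)
  moreover have "\<phi> g ` \<Inter>{C. closed_invariant C} \<subseteq> \<Inter>{C. closed_invariant C}" if "g \<in> carrier G" for g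
    using that unfolding closed_invariant_def by blast
  ultimately show ?thesis
    unfolding minimal_set_def closed_invariant_def[of "\<Inter>{C. closed_invariant C}"] by blast
qed

lemma minimal_set_subset: "minimal_set \<subseteq> topspace X"
  using closed_invariant_minimal_set closedin_subset by (auto simp: closed_invariant_def)

text \<open>The points whose orbits miss \<open>U\<close> form a closed invariant set. If there were
  any, this set would contain \<open>m\<close>, but the identity already puts \<open>m\<close> into
  \<open>U\<close>.\<close>

lemma orbit_meets:
  assumes m: "m \<in> minimal_set" and U: "openin X U" "m \<in> U" and x: "x \<in> topspace X"
  shows "\<exists>g\<in>carrier G. \<phi> g x \<in> U"
proof (rule ccontr)
  assume no: "\<not> ?thesis"
  define V where "V = (\<Union>g\<in>carrier G. {y \<in> topspace X. \<phi> g y \<in> U})"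
  have "openin X V" unfolding V_def using openin_translate[OF _ U(1)] by blast
  moreover have "\<phi> h y \<in> topspace X - V" if h: "h \<in> carrier G" and y: "y \<in> topspace X - V" for h y
  proof -
    have "\<phi> g (\<phi> h y) \<notin> U" if g: "g \<in> carrier G" for g
    proof -
      have "\<phi> g (\<phi> h y) = \<phi> (g \<otimes> h) y" using composition_rule[of y g h] y g h by simp
      then show ?thesis
        using y g h monoid.m_closed[OF group.is_monoid[OF group_G] g h] by (auto simp: V_def)
    qed
    then show ?thesis using action_closed h y by (auto simp: V_def)
  qed
  ultimately have "closed_invariant (topspace X - V)"
    using no x by (auto simp: closed_invariant_def V_def)
  then have "m \<notin> V" using m by (auto simp: minimal_set_def)
  moreover have "\<phi> \<one> m = m"
    using id_eq_one m minimal_set_subset by (metis restrict_apply' subsetD)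
  ultimately show False
    using m U minimal_set_subset monoid.one_closed[OF group.is_monoid[OF group_G]]
    by (auto simp: V_def)
qed

text \<open>The target of a contraction can be prescribed: contract towards some \<open>z\<close>,
  then apply an element \<open>h\<close> that moves \<open>z\<close> into \<open>U\<close>.\<close>

lemma contracts_pairs_to:
  assumes m: "m \<in> minimal_set" and U: "openin X U" "m \<in> U" and xy: "x \<in> topspace X" "y \<in> topspace X"
  shows "\<exists>g\<in>carrier G. \<phi> g x \<in> U \<and> \<phi> g y \<in> U"
proof -
  obtain z where z: "z \<in> topspace X"
    and near: "\<And>U. openin X U \<Longrightarrow> z \<in> U \<Longrightarrow> \<exists>g\<in>carrier G. \<phi> g x \<in> U \<and> \<phi> g y \<in> U"
    using contracts_pairs[OF xy] by meson
  obtain h where h: "h \<in> carrier G" "\<phi> h z \<in> U" using orbit_meets[OF m U z] by blast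
  obtain g where g: "g \<in> carrier G" "\<phi> h (\<phi> g x) \<in> U" "\<phi> h (\<phi> g y) \<in> U"
    using near[OF openin_translate[OF h(1) U(1)]] h z by blast
  show ?thesis
  proof
    show "h \<otimes> g \<in> carrier G" using h g group_G by (simp add: group.is_monoid monoid.m_closed)
    show "\<phi> (h \<otimes> g) x \<in> U \<and> \<phi> (h \<otimes> g) y \<in> U"
      using composition_rule[of _ h g] xy h g by simp
  qed
qed

lemma contracts_finite_to:
  assumes m: "m \<in> minimal_set" and U: "openin X U" "m \<in> U" and S: "finite S" "S \<subseteq> topspace X"
  shows "\<exists>g\<in>carrier G. \<phi> g ` S \<subseteq> U"
  using S U
proof (induction S arbitrary: U rule: finite_induct)
  case empty
  then show ?case using monoid.one_closed[OF group.is_monoid[OF group_G]] by auto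
next
  case (insert y S)
  have mX: "m \<in> topspace X" using m minimal_set_subset by blast
  \<comment> \<open>By compactness, finitely many translates of \<open>U\<close> that contain \<open>m\<close> cover \<open>X\<close>;
    an element that moves \<open>S\<close> into their intersection moves \<open>y\<close> into one of them.\<close>
  have "\<exists>h\<in>carrier G. \<phi> h w \<in> U \<and> \<phi> h m \<in> U" if "w \<in> topspace X" for w
    using contracts_pairs_to[OF m insert.prems(2,3) that mX] .
  then have "topspace X \<subseteq> (\<Union>h\<in>{h \<in> carrier G. \<phi> h m \<in> U}. {w \<in> topspace X. \<phi> h w \<in> U})" by blast
  moreover have "\<forall>W\<in>(\<lambda>h. {w \<in> topspace X. \<phi> h w \<in> U}) ` {h \<in> carrier G. \<phi> h m \<in> U}. openin X W"
    using openin_translate[OF _ insert.prems(2)] by blast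
  ultimately obtain \<F> where \<F>: "finite \<F>" "topspace X \<subseteq> \<Union>\<F>"
      "\<F> \<subseteq> (\<lambda>h. {w \<in> topspace X. \<phi> h w \<in> U}) ` {h \<in> carrier G. \<phi> h m \<in> U}"
    using compact unfolding compact_space_alt by meson
  have "openin X (topspace X \<inter> \<Inter>\<F>)"
    using \<F> openin_translate[OF _ insert.prems(2)] by (intro openin_Int_Inter) auto
  moreover have "m \<in> topspace X \<inter> \<Inter>\<F>" using mX \<F>(3) by blast
  ultimately obtain g where g: "g \<in> carrier G" "\<phi> g ` S \<subseteq> topspace X \<inter> \<Inter>\<F>"
    using insert.IH insert.prems(1) by (metis insert_subset)
  have "\<phi> g y \<in> topspace X" using action_closed g(1) insert.prems(1) by blast
  then obtain W where "W \<in> \<F>" "\<phi> g y \<in> W" using \<F>(2) by blast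
  then obtain h where h: "h \<in> carrier G" "\<And>w. w \<in> insert y S \<Longrightarrow> \<phi> h (\<phi> g w) \<in> U"
    using \<F>(3) g(2) by blast
  show ?case
  proof
    show "h \<otimes> g \<in> carrier G" using h g group_G by (simp add: group.is_monoid monoid.m_closed)
    show "\<phi> (h \<otimes> g) ` insert y S \<subseteq> U"
    proof
      fix u assume "u \<in> \<phi> (h \<otimes> g) ` insert y S"
      then obtain w where w: "w \<in> insert y S" "u = \<phi> (h \<otimes> g) w" by blast
      then have "u = \<phi> h (\<phi> g w)"
        using composition_rule[of w h g] insert.prems(1) h(1) g(1) by blast
      then show "u \<in> U" using h(2)[OF w(1)] by simp
    qed
  qed
qed

lemma minimal_set_subset_finite_index:
  assumes H: "H \<subseteq> carrier G" "\<one> \<in> H" "finite (rcosets H)"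
    and P: "closedin X P" "P \<noteq> {}" "\<And>h. h \<in> H \<Longrightarrow> \<phi> h ` P \<subseteq> P"
  shows "minimal_set \<subseteq> P"
proof
  fix m assume m: "m \<in> minimal_set"
  interpret group G by (rule group_G)
  have "rcosets H = (\<lambda>a. H #> a) ` carrier G" by (auto simp: RCOSETS_def)
  then obtain R where R: "R \<subseteq> carrier G" "finite R" "(\<lambda>a. H #> a) ` carrier G = (\<lambda>a. H #> a) ` R"
    using H(3) finite_subset_image[of "rcosets H" "\<lambda>a. H #> a" "carrier G"] by auto
  have coset: "\<exists>r\<in>R. \<exists>h\<in>H. g = h \<otimes> r" if g: "g \<in> carrier G" for g
  proof -
    have "g = \<one> \<otimes> g" using g by simp
    then have "g \<in> H #> g" using H(2) unfolding r_coset_def by blast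
    moreover obtain r where "r \<in> R" "H #> g = H #> r" using R(3) g by blast
    ultimately show ?thesis by (auto simp: r_coset_def)
  qed
  obtain x where x: "x \<in> P" "x \<in> topspace X" using P(1,2) closedin_subset by blast
  show "m \<in> P"
  proof (rule ccontr)
    assume "m \<notin> P"
    then have "openin X (topspace X - P)" "m \<in> topspace X - P"
      using m minimal_set_subset P(1) by auto
    \<comment> \<open>The inverses match right cosets: writing \<open>g = h \<otimes> r\<close>
      gives \<open>g \<otimes> inv r = h \<in> H\<close>, so any \<open>g\<close> sends at least one
      of these translates of \<open>x\<close> back into \<open>P\<close>.\<close>
    moreover have "(\<lambda>r. \<phi> (inv r) x) ` R \<subseteq> topspace X" using R(1) x action_closed by auto
    ultimately obtain g where g: "g \<in> carrier G" "\<phi> g ` (\<lambda>r. \<phi> (inv r) x) ` R \<subseteq> topspace X - P"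
      using contracts_finite_to[OF m] R(2) by (meson finite_imageI)
    obtain r h where rh: "r \<in> R" "h \<in> H" "g = h \<otimes> r" using coset[OF g(1)] by blast
    have rc: "r \<in> carrier G" "h \<in> carrier G" using rh R(1) H(1) by auto
    have "\<phi> g (\<phi> (inv r) x) = \<phi> (h \<otimes> r \<otimes> inv r) x"
      using composition_rule[OF x(2) g(1), of "inv r"] rc rh by simp
    also have "h \<otimes> r \<otimes> inv r = h" using rc by (simp add: m_assoc)
    finally have "\<phi> g (\<phi> (inv r) x) \<in> P" using P(3)[OF rh(2)] x by auto
    then show False using g(2) rh(1) by blast
  qed
qed

end

section \<open>Passage between a group and a commensurated subgroup\<close>

lemma action_by_homeos_subgroup:
  assumes "action_by_homeos \<Gamma> X \<phi>" "subgroup \<Lambda> \<Gamma>"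
  shows "action_by_homeos (\<Gamma>\<lparr>carrier := \<Lambda>\<rparr>) X \<phi>"
  using assms group_action.induced_action subgroup.subset
  by (fastforce simp: action_by_homeos_def)

lemma strongly_proximal_mono:
  assumes "\<Lambda> \<subseteq> carrier \<Gamma>" "strongly_proximal (\<Gamma>\<lparr>carrier := \<Lambda>\<rparr>) X \<phi>"
  shows "strongly_proximal \<Gamma> X \<phi>"
  unfolding strongly_proximal_def proximal_def
proof (intro ballI)
  fix \<mu> \<nu> assume "\<mu> \<in> topspace (weak_star X)" "\<nu> \<in> topspace (weak_star X)"
  then obtain F z where "F \<noteq> bot" "\<forall>\<^sub>F g in F. g \<in> \<Lambda>"
      "limitin (weak_star X) (\<lambda>g. distr \<mu> (borel_of X) (\<phi> g)) z F"
      "limitin (weak_star X) (\<lambda>g. distr \<nu> (borel_of X) (\<phi> g)) z F"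
    using assms(2) unfolding strongly_proximal_def proximal_def by fastforce
  moreover have "\<forall>\<^sub>F g in F. g \<in> carrier \<Gamma>"
    using \<open>\<forall>\<^sub>F g in F. g \<in> \<Lambda>\<close> by eventually_elim (use assms(1) in blast)
  ultimately show "\<exists>F. F \<noteq> bot \<and> (\<forall>\<^sub>F g in F. g \<in> carrier \<Gamma>) \<and>
      (\<exists>z. limitin (weak_star X) (\<lambda>g. distr \<mu> (borel_of X) (\<phi> g)) z F \<and>
           limitin (weak_star X) (\<lambda>g. distr \<nu> (borel_of X) (\<phi> g)) z F)"
    by blast
qed

lemma minimal_action_commensurated:
  assumes comm: "commensurated \<Lambda> \<Gamma>" and bd: "boundary \<Gamma> X \<phi>"
    and sp: "strongly_proximal (\<Gamma>\<lparr>carrier := \<Lambda>\<rparr>) X \<phi>"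
  shows "minimal_action (\<Gamma>\<lparr>carrier := \<Lambda>\<rparr>) X \<phi>"
proof -
  let ?L = "\<Gamma>\<lparr>carrier := \<Lambda>\<rparr>"
  have sub: "subgroup \<Lambda> \<Gamma>"
    and fin: "\<And>g. g \<in> carrier \<Gamma> \<Longrightarrow>
      finite (rcosets\<^bsub>?L\<^esub> (\<Lambda> \<inter> (\<lambda>h. g \<otimes>\<^bsub>\<Gamma>\<^esub> h \<otimes>\<^bsub>\<Gamma>\<^esub> inv\<^bsub>\<Gamma>\<^esub> g) ` \<Lambda>))"
    using comm by (auto simp: commensurated_def)
  have X: "compact_space X" "Hausdorff_space X" "topspace X \<noteq> {}" and act: "action_by_homeos \<Gamma> X \<phi>"
    and mn: "minimal_action \<Gamma> X \<phi>"
    using bd by (auto simp: boundary_def)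
  have hm: "homeomorphic_map X X (\<phi> g)" if "g \<in> carrier \<Gamma>" for g
    using act that by (simp add: action_by_homeos_def)
  interpret \<Gamma>: group_action \<Gamma> "topspace X" \<phi> using act by (simp add: action_by_homeos_def)
  interpret group \<Gamma> using \<Gamma>.group_hom group_hom.axioms(1) by blast
  have \<Lambda>: "h \<in> carrier \<Gamma>" if "h \<in> \<Lambda>" for h using sub that subgroup.subset by blast
  interpret L: proximal_flow ?L X \<phi>
  proof
    show "action_by_homeos ?L X \<phi>" using action_by_homeos_subgroup[OF act sub] .
    show "\<exists>z\<in>topspace X. \<forall>U. openin X U \<and> z \<in> U \<longrightarrow> (\<exists>g\<in>carrier ?L. \<phi> g x \<in> U \<and> \<phi> g y \<in> U)"
      if "x \<in> topspace X" "y \<in> topspace X" for x y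
      by (rule strongly_proximal_contracts_pairs[OF X(1,2) _ sp that]) (use hm \<Lambda> in simp)
  qed (use X in auto)
  let ?M = "L.minimal_set"
  have M: "closedin X ?M" "?M \<noteq> {}" "\<And>h. h \<in> \<Lambda> \<Longrightarrow> \<phi> h ` ?M \<subseteq> ?M" "?M \<subseteq> topspace X"
    using L.closed_invariant_minimal_set L.minimal_set_subset
    by (auto simp: L.closed_invariant_def)
  have expand: "?M \<subseteq> \<phi> g ` ?M" if g: "g \<in> carrier \<Gamma>" for g
  proof (rule L.minimal_set_subset_finite_index)
    let ?H = "\<Lambda> \<inter> (\<lambda>h. g \<otimes>\<^bsub>\<Gamma>\<^esub> h \<otimes>\<^bsub>\<Gamma>\<^esub> inv\<^bsub>\<Gamma>\<^esub> g) ` \<Lambda>"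
    have "\<one>\<^bsub>\<Gamma>\<^esub> = g \<otimes>\<^bsub>\<Gamma>\<^esub> \<one>\<^bsub>\<Gamma>\<^esub> \<otimes>\<^bsub>\<Gamma>\<^esub> inv\<^bsub>\<Gamma>\<^esub> g" using g by simp
    then show "\<one>\<^bsub>?L\<^esub> \<in> ?H" using subgroup.one_closed[OF sub] by auto
    show "finite (rcosets\<^bsub>?L\<^esub> ?H)" using fin[OF g] .
    show "closedin X (\<phi> g ` ?M)"
      using homeomorphic_imp_closed_map[OF hm[OF g]] M(1) by (simp add: closed_map_def)
    \<comment> \<open>Conjugation by \<open>g\<close> turns \<open>h\<close> into some
      \<open>k \<in> \<Lambda>\<close>, which preserves \<open>?M\<close>.\<close>
    show "\<phi> h ` \<phi> g ` ?M \<subseteq> \<phi> g ` ?M" if "h \<in> ?H" for h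
    proof -
      obtain k where k: "k \<in> \<Lambda>" "h = g \<otimes>\<^bsub>\<Gamma>\<^esub> k \<otimes>\<^bsub>\<Gamma>\<^esub> inv\<^bsub>\<Gamma>\<^esub> g" using \<open>h \<in> ?H\<close> by blast
      have eq: "h \<otimes>\<^bsub>\<Gamma>\<^esub> g = g \<otimes>\<^bsub>\<Gamma>\<^esub> k" and hc: "h \<in> carrier \<Gamma>"
        using k \<Lambda> g by (simp_all add: m_assoc)
      have "\<phi> h (\<phi> g m) = \<phi> g (\<phi> k m)" if "m \<in> ?M" for m
        using that M(4) \<Gamma>.composition_rule[of m h g] \<Gamma>.composition_rule[of m g k] eq hc g k \<Lambda>
        by auto
      then show ?thesis using M(3)[OF k(1)] by auto
    qed
  qed (use M in auto)
  \<comment> \<open>The reverse inclusion is \<open>expand\<close> for the inverse of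
    \<open>g\<close>, moved across by \<open>\<phi> g\<close>. Minimality of \<open>\<Gamma>\<close>
    then forces \<open>?M\<close> to be the whole space.\<close>
  have "\<phi> g ` ?M \<subseteq> ?M" if g: "g \<in> carrier \<Gamma>" for g
  proof
    fix y assume "y \<in> \<phi> g ` ?M"
    then obtain m where m: "m \<in> ?M" "y = \<phi> g m" by blast
    then obtain m' where m': "m' \<in> ?M" "m = \<phi> (inv\<^bsub>\<Gamma>\<^esub> g) m'" using expand[of "inv\<^bsub>\<Gamma>\<^esub> g"] g by blast
    then have "\<phi> g m = m'"
      using M(4) g \<Gamma>.orbit_sym_aux[of "inv\<^bsub>\<Gamma>\<^esub> g" m' m] by auto
    then show "y \<in> ?M" using m m' by simp
  qed
  then have "?M = topspace X" using mn M(1,2) unfolding minimal_action_def by blast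
  then show ?thesis
    unfolding minimal_action_def
  proof (intro allI impI)
    fix C assume C: "closedin X C \<and> (\<forall>g\<in>carrier ?L. \<phi> g ` C \<subseteq> C)"
    then have "?M \<subseteq> C" if "C \<noteq> {}"
      unfolding L.minimal_set_def using that by (intro Inter_lower) (simp add: L.closed_invariant_def)
    then show "C = {} \<or> C = topspace X"
      using \<open>?M = topspace X\<close> C closedin_subset by blast
  qed
qed

section \<open>Comparison of the two universal boundaries\<close>

theorem corollary4p5:
  fixes \<Gamma> :: "('g, 'm) monoid_scheme" and \<Lambda> :: "'g set"
    and B :: "'a topology" and \<beta> :: "'g \<Rightarrow> 'a \<Rightarrow> 'a"
    and F :: "'b topology" and \<phi> \<psi> :: "'g \<Rightarrow> 'b \<Rightarrow> 'b"
  assumes "group \<Gamma>"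
    and "commensurated \<Lambda> \<Gamma>"
    and "relative_boundary \<Gamma> \<Lambda> B \<beta>"
    and "furstenberg_boundary (\<Gamma>\<lparr>carrier := \<Lambda>\<rparr>) F \<phi>"
    and "action_by_homeos \<Gamma> F \<psi>"
    and "\<forall>h\<in>\<Lambda>. \<forall>x\<in>topspace F. \<psi> h x = \<phi> h x"
  shows "\<exists>f. homeomorphic_map B F f \<and> equivariant \<Gamma> B \<beta> \<psi> f"
proof -
  let ?L = "\<Gamma>\<lparr>carrier := \<Lambda>\<rparr>"
  have sub: "subgroup \<Lambda> \<Gamma>" using assms(2) by (simp add: commensurated_def)
  then have \<Lambda>: "\<Lambda> \<subseteq> carrier \<Gamma>" by (rule subgroup.subset)
  have bB: "boundary \<Gamma> B \<beta>" and spB: "strongly_proximal ?L B \<beta>"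
    using assms(3) by (auto simp: relative_boundary_def)
  have bF: "boundary ?L F \<phi>" using assms(4) by (simp add: furstenberg_boundary_def)
  then have F: "compact_space F" "Hausdorff_space F" "topspace F \<noteq> {}" and mnF: "minimal_action ?L F \<phi>"
    and spF: "strongly_proximal ?L F \<phi>"
    and hmF: "\<And>h. h \<in> \<Lambda> \<Longrightarrow> homeomorphic_map F F (\<phi> h)"
    by (auto simp: boundary_def action_by_homeos_def)
  have memF: "\<phi> h x \<in> topspace F" if "h \<in> \<Lambda>" "x \<in> topspace F" for h x
    using hmF[OF that(1)] that(2) homeomorphic_imp_surjective_map by blast
  \<comment> \<open>Since \<open>\<psi>\<close> and \<open>\<phi>\<close> are assumed to agree for
    \<open>\<Lambda>\<close> on the points of \<open>F\<close>, the identity of \<open>F\<close> is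
    equivariant and transports strong proximality.\<close>
  have sp\<psi>: "strongly_proximal ?L F \<psi>"
    by (rule strongly_proximal_homeomorphic[OF homeomorphic_map_id[THEN iffD2] spF, of F])
      (use hmF assms(5,6) \<Lambda> in \<open>auto simp: action_by_homeos_def equivariant_def\<close>)
  have "minimal_action \<Gamma> F \<psi>"
    unfolding minimal_action_def
  proof (intro allI impI)
    fix C assume C: "closedin F C \<and> (\<forall>g\<in>carrier \<Gamma>. \<psi> g ` C \<subseteq> C)"
    then have "\<phi> h ` C \<subseteq> C" if "h \<in> \<Lambda>" for h
      using that \<Lambda> assms(6) closedin_subset by (fastforce simp: image_subset_iff)
    then show "C = {} \<or> C = topspace F" using mnF C unfolding minimal_action_def by simp
  qed
  \<comment> \<open>Minimality and strong proximality pass from \<open>\<Lambda>\<close> up to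
    \<open>\<Gamma>\<close>, so \<open>F\<close> with the extended action falls under the universal
    property of \<open>B\<close>.\<close>
  then have "boundary \<Gamma> F \<psi>"
    using F assms(5) strongly_proximal_mono[OF \<Lambda> sp\<psi>] by (simp add: boundary_def)
  then have "equivariant_image \<Gamma> B \<beta> F \<psi>"
    using relative_boundary_universal[OF \<Lambda> assms(3) _ sp\<psi>] by blast
  then obtain p where p: "continuous_map B F p" "p ` topspace B = topspace F" "equivariant \<Gamma> B \<beta> \<psi> p"
    by (auto simp: equivariant_image_def)
  \<comment> \<open>Commensuration enters here. The resulting \<open>q\<close> is equivariant for
    \<open>\<Lambda>\<close>, which suffices to invert \<open>p\<close>; the equivariance for
    \<open>\<Gamma>\<close> comes from \<open>p\<close>.\<close>
  have "boundary ?L B \<beta>"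
    using bB spB minimal_action_commensurated[OF assms(2) bB spB] action_by_homeos_subgroup[OF _ sub, of B \<beta>]
    by (simp add: boundary_def)
  then obtain q where q: "continuous_map F B q" "q ` topspace F = topspace B" "equivariant ?L F \<phi> \<beta> q"
    using furstenberg_boundary_universal[OF assms(4), of B \<beta>] by (auto simp: equivariant_image_def)
  have q_mem: "q x \<in> topspace B" if "x \<in> topspace F" for x using q(2) that by blast
  have pq: "(p \<circ> q) x = id x" if "x \<in> topspace F" for x
  proof (rule equivariant_maps_equal[OF F(1,3) mnF _ F(2) _ _ _ _ _ that])
    show "continuous_map F F (p \<circ> q)" using continuous_map_compose[OF q(1) p(1)] .
    show "equivariant ?L F \<phi> \<phi> (p \<circ> q)"
      using p(2,3) q(3) q_mem \<Lambda> assms(6) by (fastforce simp: equivariant_def)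
    show "\<exists>z\<in>topspace F. \<forall>U. openin F U \<and> z \<in> U \<longrightarrow> (\<exists>g\<in>carrier ?L. \<phi> g x \<in> U \<and> \<phi> g y \<in> U)"
      if "x \<in> topspace F" "y \<in> topspace F" for x y
      by (rule strongly_proximal_contracts_pairs[OF F(1,2) _ spF that]) (use hmF in simp)
  qed (use memF in \<open>auto simp: equivariant_def\<close>)
  \<comment> \<open>Surjectivity of \<open>q\<close> turns the identity
    \<open>p \<circ> q = id\<close> on \<open>F\<close> into injectivity of \<open>p\<close>; a
    continuous bijection from a compact to a Hausdorff space is a homeomorphism.\<close>
  have "inj_on p (topspace B)"
  proof (rule inj_onI)
    fix u v assume uv: "u \<in> topspace B" "v \<in> topspace B" "p u = p v"
    then obtain x y where "x \<in> topspace F" "y \<in> topspace F" "u = q x" "v = q y" using q(2) by blast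
    then show "u = v" using pq uv(3) by fastforce
  qed
  then have "homeomorphic_map B F p"
    using continuous_imp_homeomorphic_map[OF p(1) _ F(2) p(2)] bB by (simp add: boundary_def)
  then show ?thesis using p(3) by blast
qed

end
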